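(* For all integers $n\ge k\ge1$, the variance of $X_{n,k}$ satisfies \begin{align*} \mathrm{Var}(X_{n,k})&=\frac{1}{12}(k^2-1)n-\frac{1}{72}k(k-1)(2k+5)\\ &\quad+\frac{1}{12}\left(-15n^2+(56k-43)n-2(k-1)(14k-1)\right)\frac{S_{n,k-1}}{S_{n,k}}\\ &\quad+\frac{1}{12}(n-k+2)(27n-27k+1)\frac{S_{n,k-2}}{S_{n,k}}-\frac94(n+1-k)^2\left(\frac{S_{n,k-1}}{S_{n,k}}\right)^2. \end{align*}
   Context: $[n]=\{1,\dots,n\}$ and $\Pi_n^k$ is the set of all partitions of $[n]$ into $k$ (nonempty) blocks; $S_{n,k}=|\Pi_n^k|$ is the Stirling number of the second kind (with $S_{n,j}=0$ for $j\le0$ and $n\ge1$). For a set partition $\pi$ of $[n]$, the arcs of its linear representation are the pairs $(i,j)$, $i<j$, where $i,j$ are consecutive elements (in increasing order) of the same block; $\mathrm{cr}^{(\ell)}(\pi)$ is the number of (unordered) pairs of crossing arcs, i.e. pairs of arcs $(i,j),(i',j')$ with $i<i'<j<j'$. $X_{n,k}$ is the random variable equal to $\mathrm{cr}^{(\ell)}(\pi)$ for $\pi$ uniformly distributed on $\Pi_n^k$. *)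

theory Defs
  imports "HOL-Probability.Probability" "HOL-Library.Disjoint_Sets"
begin

definition set_partitions :: "nat \<Rightarrow> nat \<Rightarrow> nat set set set" where
  "set_partitions n k = {P. partition_on {1..n} P \<and> card P = k}"

text \<open>
  The second index is an integer, so that \<open>S n (k - 2)\<close> with \<open>k = 1\<close> is literally \<open>S n (-1) = 0\<close>
  rather than a truncated subtraction on natural numbers.
\<close>

definition S :: "nat \<Rightarrow> int \<Rightarrow> nat" where
  "S n j = (if j < 0 then 0 else card (set_partitions n (nat j)))"

definition arcs :: "nat set set \<Rightarrow> (nat \<times> nat) set" where
  "arcs P = {(i, j). i < j \<and> (\<exists>B\<in>P. i \<in> B \<and> j \<in> B \<and> (\<forall>m\<in>B. \<not> (i < m \<and> m < j)))}"

text \<open>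
  An unordered pair of crossing arcs is represented by the unique ordered pair in which the arc with
  the smaller left endpoint comes first.
\<close>

definition crossings :: "nat set set \<Rightarrow> nat" where
  "crossings P = card {((i, j), (i', j')).
     (i, j) \<in> arcs P \<and> (i', j') \<in> arcs P \<and> i < i' \<and> i' < j \<and> j < j'}"

definition uniform_partition :: "nat \<Rightarrow> nat \<Rightarrow> nat set set pmf" where
  "uniform_partition n k = pmf_of_set (set_partitions n k)"

text \<open>
  \<open>pmf_of_set\<close> is the uniform distribution only on a finite nonempty set; the following two lemmas
  show that this is the case here.
\<close>

lemma finite_set_partitions: "finite (set_partitions n k)"
proof (rule finite_subset)
  show "set_partitions n k \<subseteq> Pow (Pow {1..n})"
    by (auto simp: set_partitions_def partition_on_def)
qed simp

lemma set_partitions_nonempty: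
  assumes "1 \<le> k" "k \<le> n"
  shows "set_partitions n k \<noteq> {}"
proof -
  define P where "P = insert {k..n} ((\<lambda>i. {i}) ` {1..<k})"
  have "partition_on {1..n} P"
    unfolding P_def partition_on_def pairwise_def disjnt_def using assms by auto
  moreover have "{k..n} \<notin> (\<lambda>i. {i}) ` {1..<k}"
  proof
    assume "{k..n} \<in> (\<lambda>i. {i}) ` {1..<k}"
    then obtain i where i: "i < k" "{k..n} = {i}" by auto
    moreover have "k \<in> {k..n}" using assms by simp
    ultimately show False by simp
  qed
  then have "card P = k"
    unfolding P_def using assms by (simp add: card_image)
  ultimately show ?thesis by (auto simp: set_partitions_def)
qed

end

theory Submission
  imports Defs "HOL-Computational_Algebra.Polynomial"
begin

text \<open>
  Read a partition of \<open>{1..n}\<close> from left to right and stop after some element: a partition \<open>P\<close> of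
  the elements read so far remains, together with the set \<open>Q\<close> of those blocks that will receive a
  further element. Call the blocks in \<open>Q\<close> open; each of them has a pending arc, which starts at its
  maximum. Let \<open>c\<close> count the crossings among the arcs of \<open>P\<close> and the pending arcs
  (\<open>open_crossings\<close>). A new element either forms a singleton, which creates no crossing, or ends
  the pending arc of an open block. In the second case the number of new crossings is the number
  of open blocks with a larger maximum; over the \<open>h\<close> open blocks it takes each of the values
  \<open>0, \<dots>, h - 1\<close> once. In either case the block of the new element may be open or closed.

  Let \<open>F n k\<close> be the sum of \<open>q^c * x^(card Q)\<close> over all partitions \<open>P\<close> of \<open>{1..n}\<close> into \<open>k\<close> blocks
  and all sets \<open>Q\<close> of open blocks. The above says
  \<open>F (n + 1) k = (1 + x) * (F n (k - 1) + D_q (F n k))\<close>, where \<open>D_q\<close> is the \<open>q\<close>-derivative, which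
  maps \<open>x^h\<close> to \<open>(1 + q + \<dots> + q^(h - 1)) * x^(h - 1)\<close>. Only the expansion up to second order at
  \<open>q = 1\<close> matters for the variance, and there
  \<open>D_q = D + (q - 1) * x / 2 * D^2 + (q - 1)^2 * x^2 / 6 * D^3 + \<dots>\<close>.
  So the coefficients of \<open>(q - 1)^j\<close> for \<open>j = 0, 1, 2\<close>, which are the sums weighted by \<open>c choose j\<close>
  (\<open>crossing_poly\<close>), satisfy the recurrences \<open>crossing_poly_0_Suc\<close>, \<open>crossing_poly_1_Suc\<close> and
  \<open>crossing_poly_2_Suc\<close>.

  In powers of \<open>y = 1 + x\<close> these recurrences have short solutions: one, two and three terms
  respectively, from \<open>y^k\<close> down to \<open>y^(k - j)\<close>. The coefficient of \<open>y^(k - i)\<close> satisfies an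
  inhomogeneous Stirling recurrence with multiplier \<open>k - i\<close>. All of them are combinations of
  \<open>S n k\<close>, \<open>S n (k - 1)\<close> and \<open>S n (k - 2)\<close> with coefficients polynomial in \<open>n\<close> and \<open>k\<close>, which is
  how the ratios of Stirling numbers enter the variance (\<open>crossing_poly_1_closed\<close>,
  \<open>crossing_poly_2_closed\<close>). Setting \<open>x = 0\<close> leaves only the partitions without open blocks and
  yields the sums of \<open>crossings P\<close> and of \<open>crossings P choose 2\<close>, hence the variance.
\<close>

section \<open>Pending arcs and the crossings they take part in\<close>

lemma arcs_insert: "arcs (insert B P) = arcs {B} \<union> arcs P"
  by (auto simp: arcs_def)

lemma arcs_singleton_block: "arcs {{a}} = {}"
  by (auto simp: arcs_def)

lemma arcs_insert_above:
  assumes "finite B" "B \<noteq> {}" "\<And>b. b \<in> B \<Longrightarrow> b < a"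
  shows "arcs {insert a B} = insert (Max B, a) (arcs {B})"
proof -
  have M: "Max B \<in> B" "\<And>b. b \<in> B \<Longrightarrow> b \<le> Max B" using assms by auto
  have "(i, j) \<in> arcs {insert a B} \<longleftrightarrow> (i, j) \<in> insert (Max B, a) (arcs {B})" for i j
  proof (cases "j = a")
    case True
    have "(i, a) \<in> arcs {insert a B} \<longleftrightarrow> i \<in> B \<and> (\<forall>m\<in>B. m \<le> i)"
      using assms(3) by (force simp: arcs_def not_less)
    also have "\<dots> \<longleftrightarrow> i = Max B" using M by (metis order_antisym)
    finally show ?thesis using True assms(3) by (auto simp: arcs_def)
  next
    case False
    then show ?thesis using assms(3) by (fastforce simp: arcs_def)
  qed
  then show ?thesis by auto
qed

definition arcs_over :: "nat set set \<Rightarrow> nat \<Rightarrow> (nat \<times> nat) set" where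
  "arcs_over P x = {(i, j) \<in> arcs P. i < x \<and> x < j}"

text \<open>
  The crossings of \<open>P\<close> once every block in \<open>Q\<close> is given a pending arc, from its maximum to a point
  beyond all elements of \<open>P\<close>. Such arcs do not cross each other, so the only new crossings are
  those with the arcs of \<open>P\<close> that pass over the maximum.
\<close>

definition open_crossings :: "nat set set \<Rightarrow> nat set set \<Rightarrow> nat" where
  "open_crossings P Q = crossings P + (\<Sum>C\<in>Q. card (arcs_over P (Max C)))"

definition extend_block :: "nat \<Rightarrow> nat set set \<Rightarrow> nat set \<Rightarrow> nat set set" where
  "extend_block a P B = insert (insert a B) (P - {B})"

lemma open_crossings_empty: "open_crossings P {} = crossings P"
  by (simp add: open_crossings_def)

context
  fixes n :: nat and P :: "nat set set"
  assumes P: "partition_on {1..n} P"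
begin

lemma block_finite: "B \<in> P \<Longrightarrow> finite B"
  and block_nonempty: "B \<in> P \<Longrightarrow> B \<noteq> {}"
  and block_le: "B \<in> P \<Longrightarrow> b \<in> B \<Longrightarrow> b \<le> n"
  and blocks_disjoint: "B \<in> P \<Longrightarrow> C \<in> P \<Longrightarrow> b \<in> B \<Longrightarrow> b \<in> C \<Longrightarrow> B = C"
  and finite_blocks: "finite P"
proof -
  show "finite P" using P by (rule finite_elements[rotated]) simp
  have sub: "B \<in> P \<Longrightarrow> B \<subseteq> {1..n}" using partition_onD1[OF P] by auto
  then show "B \<in> P \<Longrightarrow> finite B" by (rule finite_subset) simp_all
  show "B \<in> P \<Longrightarrow> b \<in> B \<Longrightarrow> b \<le> n" using sub by auto
  show "B \<in> P \<Longrightarrow> B \<noteq> {}" using partition_onD3[OF P] by auto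
  show "B \<in> P \<Longrightarrow> C \<in> P \<Longrightarrow> b \<in> B \<Longrightarrow> b \<in> C \<Longrightarrow> B = C"
    using partition_onD2[OF P] unfolding disjoint_def by blast
qed

lemma Max_block: "B \<in> P \<Longrightarrow> Max B \<in> B" "B \<in> P \<Longrightarrow> Max B \<le> n"
  using block_finite block_nonempty block_le Max_in by blast+

lemma inj_on_Max_blocks: "inj_on Max P"
  by (rule inj_onI) (metis Max_block(1) blocks_disjoint)

lemma arcs_le: "(i, j) \<in> arcs P \<Longrightarrow> i < j \<and> j \<le> n"
  using block_le by (auto simp: arcs_def)

lemma finite_arcs: "finite (arcs P)"
  by (rule finite_subset[of _ "{..n} \<times> {..n}"]) (use arcs_le in fastforce)+

lemma finite_arcs_over: "finite (arcs_over P x)"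
  by (rule finite_subset[OF _ finite_arcs]) (auto simp: arcs_over_def)

lemma arcs_add_singleton: "arcs (insert {a} P) = arcs P"
  by (subst arcs_insert) (simp add: arcs_singleton_block)

text \<open>
  No arc passes over the new element \<open>Suc n\<close>, so neither a closed nor an open new singleton takes
  part in a crossing.
\<close>

lemma open_crossings_add_singleton:
  assumes "Q \<subseteq> P"
  shows "open_crossings (insert {Suc n} P) Q = open_crossings P Q"
    and "open_crossings (insert {Suc n} P) (insert {Suc n} Q) = open_crossings P Q"
proof -
  have *: "arcs_over (insert {Suc n} P) = arcs_over P"
    "crossings (insert {Suc n} P) = crossings P"
    by (simp_all add: fun_eq_iff arcs_over_def crossings_def arcs_add_singleton)
  show "open_crossings (insert {Suc n} P) Q = open_crossings P Q"
    by (simp add: open_crossings_def *)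
  have "arcs_over P (Suc n) = {}" using arcs_le by (fastforce simp: arcs_over_def)
  moreover have "finite Q" "{Suc n} \<notin> Q"
    using assms finite_blocks finite_subset block_le by (blast, fastforce)
  ultimately show "open_crossings (insert {Suc n} P) (insert {Suc n} Q) = open_crossings P Q"
    by (simp add: open_crossings_def *)
qed

lemma arcs_extend_block:
  assumes "B \<in> P"
  shows "arcs (extend_block (Suc n) P B) = insert (Max B, Suc n) (arcs P)"
proof -
  have "arcs {insert (Suc n) B} = insert (Max B, Suc n) (arcs {B})"
    by (rule arcs_insert_above) (use assms block_finite block_nonempty block_le in \<open>auto simp: less_Suc_eq_le\<close>)
  then have "arcs (extend_block (Suc n) P B) = insert (Max B, Suc n) (arcs {B} \<union> arcs (P - {B}))"
    unfolding extend_block_def by (subst arcs_insert) simp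
  also have "arcs {B} \<union> arcs (P - {B}) = arcs P"
    using assms by (subst arcs_insert[symmetric]) (simp add: insert_absorb)
  finally show ?thesis .
qed

lemma card_arcs_over_extend_block:
  assumes "B \<in> P" "x \<le> n"
  shows "card (arcs_over (extend_block (Suc n) P B) x) = card (arcs_over P x) + of_bool (Max B < x)"
proof -
  have "arcs_over (extend_block (Suc n) P B) x
      = (if Max B < x then insert (Max B, Suc n) (arcs_over P x) else arcs_over P x)"
    using assms by (auto simp: arcs_over_def arcs_extend_block)
  moreover have "(Max B, Suc n) \<notin> arcs_over P x" using arcs_le by (fastforce simp: arcs_over_def)
  ultimately show ?thesis by (simp add: finite_arcs_over)
qed

lemma crossings_extend_block:
  assumes "B \<in> P"
  shows "crossings (extend_block (Suc n) P B) = crossings P + card (arcs_over P (Max B))"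
proof -
  define X where "X = {((i, j), (i', j')).
     (i, j) \<in> arcs P \<and> (i', j') \<in> arcs P \<and> i < i' \<and> i' < j \<and> j < j'}"
  have "{((i, j), (i', j')). (i, j) \<in> arcs (extend_block (Suc n) P B) \<and>
      (i', j') \<in> arcs (extend_block (Suc n) P B) \<and> i < i' \<and> i' < j \<and> j < j'}
    = X \<union> (\<lambda>e. (e, (Max B, Suc n))) ` arcs_over P (Max B)"
    using arcs_le Max_block(2)[OF assms]
    by (fastforce simp: X_def arcs_extend_block[OF assms] arcs_over_def less_Suc_eq_le image_iff dest: leD)
  moreover have "finite X"
    by (rule finite_subset[of _ "arcs P \<times> arcs P"]) (auto simp: X_def finite_arcs)
  moreover note finite_arcs_over[of "Max B"]
  moreover have "X \<inter> (\<lambda>e. (e, (Max B, Suc n))) ` arcs_over P (Max B) = {}"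
    using arcs_le by (fastforce simp: X_def)
  moreover have "inj_on (\<lambda>e. (e, (Max B, Suc n))) (arcs_over P (Max B))"
    by (auto intro: inj_onI)
  ultimately have "crossings (extend_block (Suc n) P B) = card X + card (arcs_over P (Max B))"
    unfolding crossings_def by (simp only: card_Un_disjoint card_image finite_imageI)
  then show ?thesis by (simp only: crossings_def X_def)
qed

text \<open>
  The pending arc of \<open>B\<close> becomes an arc \<open>(Max B, Suc n)\<close>. The crossings it had as a pending arc
  remain, and it now also crosses the pending arcs of the open blocks \<open>C\<close> with \<open>Max B < Max C\<close>,
  since these end later. If the extended block is left open, its new pending arc starts at
  \<open>Suc n\<close> and crosses nothing.
\<close>

lemma open_crossings_extend_block:
  assumes "Q \<subseteq> P" "B \<in> Q"
  defines "P' \<equiv> extend_block (Suc n) P B"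
    and "c \<equiv> open_crossings P Q + card {C \<in> Q. Max B < Max C}"
  shows "open_crossings P' (Q - {B}) = c"
    and "open_crossings P' (insert (insert (Suc n) B) (Q - {B})) = c"
proof -
  have B: "B \<in> P" and Q: "finite Q" using assms finite_blocks finite_subset by blast+
  have "(\<Sum>C\<in>Q - {B}. card (arcs_over P' (Max C)))
      = (\<Sum>C\<in>Q - {B}. card (arcs_over P (Max C)) + of_bool (Max B < Max C))"
    unfolding P'_def
    by (intro sum.cong refl card_arcs_over_extend_block B Max_block) (use assms in auto)
  also have "\<dots> = (\<Sum>C\<in>Q - {B}. card (arcs_over P (Max C))) + card {C \<in> Q. Max B < Max C}"
    using Q by (auto simp: sum.distrib Int_def intro!: arg_cong[where f = card])
  also have "card (arcs_over P (Max B)) + \<dots>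
      = (\<Sum>C\<in>Q. card (arcs_over P (Max C))) + card {C \<in> Q. Max B < Max C}"
    using Q assms by (simp add: sum.remove)
  finally show 1: "open_crossings P' (Q - {B}) = c"
    by (simp add: open_crossings_def P'_def crossings_extend_block[OF B] c_def)
  have "Max (insert (Suc n) B) = Suc n"
    using Max_block(2)[OF B] by (simp add: B block_finite block_nonempty del: Max_le_iff)
  moreover have "arcs_over P' (Suc n) = {}"
    using arcs_le by (fastforce simp: arcs_over_def P'_def arcs_extend_block[OF B])
  moreover have "insert (Suc n) B \<notin> Q" using assms(1) block_le by fastforce
  ultimately show "open_crossings P' (insert (insert (Suc n) B) (Q - {B})) = c"
    using 1 Q by (simp add: open_crossings_def)
qed

text \<open>
  Distinct blocks have distinct maxima. So if \<open>B\<close> runs through the open blocks, the number of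
  crossings created by closing its pending arc takes every value below \<open>card Q\<close> exactly once;
  this is where the \<open>q\<close>-integer \<open>1 + q + \<dots> + q^(card Q - 1)\<close> comes from.
\<close>

lemma sum_open_blocks_rank:
  assumes "Q \<subseteq> P"
  shows "(\<Sum>B\<in>Q. f (card {C \<in> Q. Max B < Max C})) = (\<Sum>r<card Q. f r)"
proof -
  have fin: "finite Q" using assms finite_blocks finite_subset by blast
  have inj: "inj_on Max Q" using inj_on_Max_blocks assms by (rule inj_on_subset)
  let ?r = "\<lambda>B. card {C \<in> Q. Max B < Max C}"
  have less: "?r C < ?r B" if "B \<in> Q" "C \<in> Q" "Max B < Max C" for B C
    by (rule psubset_card_mono) (use fin that in auto)
  have "inj_on ?r Q"
  proof (rule inj_onI)
    fix B C assume *: "B \<in> Q" "C \<in> Q" "?r B = ?r C"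
    then have "Max B = Max C" using less[of B C] less[of C B] by linarith
    then show "B = C" using * inj by (auto dest: inj_onD)
  qed
  moreover have "?r ` Q = {..<card Q}"
  proof (rule card_subset_eq)
    have "?r B < card Q" if "B \<in> Q" for B
      by (rule psubset_card_mono) (use fin that in auto)
    then show "?r ` Q \<subseteq> {..<card Q}" by auto
    show "card (?r ` Q) = card {..<card Q}" using \<open>inj_on ?r Q\<close> by (simp add: card_image)
  qed simp
  ultimately show ?thesis using sum.reindex[of ?r Q f] by simp
qed

end

section \<open>Removing the largest element of a partition\<close>

lemma set_partitions_0: "set_partitions 0 k = (if k = 0 then {{}} else {})"
  by (auto simp: set_partitions_def partition_on_empty)

lemma set_partitions_Suc_0: "set_partitions (Suc n) 0 = {}"
proof -
  have False if "partition_on {1..Suc n} P" "card P = 0" for P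
    using that partition_onD1[OF that(1)] finite_blocks[OF that(1)] by simp
  then show ?thesis by (auto simp: set_partitions_def)
qed

lemma set_partitionsD:
  assumes "P \<in> set_partitions n k"
  shows "partition_on {1..n} P" "finite P" "card P = k"
  using assms finite_blocks by (auto simp: set_partitions_def)

lemma partition_on_insert_iff:
  assumes "B \<noteq> {}" "B \<subseteq> A" "B \<notin> P"
  shows "partition_on A (insert B P) \<longleftrightarrow> partition_on (A - B) P"
proof -
  have "disjnt B (\<Union>P)" if "partition_on A (insert B P)"
    using partition_onD2[OF that] assms by (auto simp: disjnt_def disjoint_def)
  moreover have "disjnt B (\<Union>P)" if "partition_on (A - B) P"
    using partition_onD1[OF that] by (auto simp: disjnt_def)
  ultimately show ?thesis using partition_on_insert[of B P A] assms by blast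
qed

lemma partition_on_Suc_insert_iff:
  assumes "B \<subseteq> {1..n}" "\<forall>C\<in>P. Suc n \<notin> C"
  shows "partition_on {1..Suc n} (insert (insert (Suc n) B) P) \<longleftrightarrow>
    partition_on ({1..n} - B) P"
proof -
  have "{1..Suc n} - insert (Suc n) B = {1..n} - B" by auto
  moreover have "insert (Suc n) B \<notin> P" using assms(2) by blast
  moreover have "insert (Suc n) B \<subseteq> {1..Suc n}" using assms(1) by auto
  ultimately show ?thesis by (simp only: partition_on_insert_iff insert_not_empty not_False_eq_True)
qed

lemma insert_block_inject:
  assumes "insert (insert a B) P = insert (insert a C) Q"
    and "a \<notin> B" "a \<notin> C" "\<forall>X\<in>P. a \<notin> X" "\<forall>X\<in>Q. a \<notin> X"
  shows "B = C" "P = Q"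
proof -
  have "insert a B \<in> insert (insert a C) Q" using assms(1) by blast
  then have 1: "insert a B = insert a C" using assms(5) by blast
  then show "B = C" using assms(2,3) by (metis insert_ident)
  have "insert a B \<notin> P" "insert a B \<notin> Q" using assms(4,5) by blast+
  then show "P = Q" using assms(1) unfolding 1 by (simp add: insert_ident)
qed

text \<open>
  Splitting off the block of \<open>Suc n\<close>; \<open>B = {}\<close> means that this block is a singleton.
\<close>

lemma block_containing_Suc:
  assumes "partition_on {1..Suc n} P"
  obtains B P' where "P = insert (insert (Suc n) B) P'" "B \<subseteq> {1..n}"
    "\<forall>C\<in>P'. Suc n \<notin> C" "partition_on ({1..n} - B) P'"
proof -
  have "Suc n \<in> \<Union>P" unfolding partition_onD1[OF assms, symmetric] by simp
  then obtain D where D: "D \<in> P" "Suc n \<in> D" by blast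
  then have "D \<subseteq> {1..Suc n}" using partition_onD1[OF assms] by blast
  define B where "B = D - {Suc n}"
  define P' where "P' = P - {D}"
  have 1: "P = insert (insert (Suc n) B) P'" using D by (simp add: B_def P'_def insert_absorb)
  have 2: "B \<subseteq> {1..n}" using \<open>D \<subseteq> {1..Suc n}\<close> by (fastforce simp: B_def le_Suc_eq)
  have 3: "\<forall>C\<in>P'. Suc n \<notin> C"
    using D blocks_disjoint[OF assms] by (auto simp: P'_def)
  show thesis using 1 2 3 assms partition_on_Suc_insert_iff[OF 2 3] that by auto
qed

text \<open>
  Every partition of \<open>{1..Suc n}\<close> arises exactly once, either by adding the singleton
  \<open>{Suc n}\<close> or by adding \<open>Suc n\<close> to a block of a partition of \<open>{1..n}\<close>.
\<close>

lemma sum_set_partitions_Suc: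
  fixes g :: "nat set set \<Rightarrow> 'a::comm_monoid_add"
  shows "sum g (set_partitions (Suc n) (Suc k)) =
    (\<Sum>P\<in>set_partitions n k. g (insert {Suc n} P)) +
    (\<Sum>P\<in>set_partitions n (Suc k). \<Sum>B\<in>P. g (extend_block (Suc n) P B))"
proof -
  let ?add = "insert {Suc n}" and ?ext = "\<lambda>(P, B). extend_block (Suc n) P B"
  let ?X = "set_partitions n k" and ?Y = "Sigma (set_partitions n (Suc k)) (\<lambda>P. P)"
  have le: "Suc n \<notin> C" if "P \<in> set_partitions n j" "C \<in> P" for P C j
    using block_le[OF set_partitionsD(1)[OF that(1)] that(2)] by fastforce
  have cases: "set_partitions (Suc n) (Suc k) = ?add ` ?X \<union> ?ext ` ?Y"
  proof (intro equalityI subsetI)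
    fix P assume P: "P \<in> set_partitions (Suc n) (Suc k)"
    obtain B P' where B: "P = insert (insert (Suc n) B) P'" "B \<subseteq> {1..n}"
      "\<forall>C\<in>P'. Suc n \<notin> C" "partition_on ({1..n} - B) P'"
      using block_containing_Suc[OF set_partitionsD(1)[OF P]] by metis
    have "finite P'" "insert (Suc n) B \<notin> P'" using set_partitionsD(2)[OF P] B by auto
    then have card: "card P' = k" using set_partitionsD(3)[OF P] B by simp
    show "P \<in> ?add ` ?X \<union> ?ext ` ?Y"
    proof (cases "B = {}")
      case True
      then show ?thesis using B card by (auto simp: set_partitions_def)
    next
      case False
      have "B \<notin> P'" using partition_onD1[OF B(4)] False by auto
      then have "partition_on {1..n} (insert B P')"
        using B False by (subst partition_on_insert_iff) auto
      then have "(insert B P', B) \<in> ?Y"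
        using card \<open>finite P'\<close> \<open>B \<notin> P'\<close> by (simp add: set_partitions_def)
      moreover have "P = ?ext (insert B P', B)"
        using B(1) \<open>B \<notin> P'\<close> by (simp add: extend_block_def)
      ultimately show ?thesis by blast
    qed
  next
    fix P' assume "P' \<in> ?add ` ?X \<union> ?ext ` ?Y"
    then show "P' \<in> set_partitions (Suc n) (Suc k)"
    proof
      assume "P' \<in> ?add ` ?X"
      then obtain P where P: "P \<in> ?X" "P' = insert {Suc n} P" by blast
      have "partition_on {1..Suc n} P'" unfolding P(2)
        by (subst partition_on_Suc_insert_iff) (use le P set_partitionsD(1)[OF P(1)] in auto)
      moreover have "{Suc n} \<notin> P" using le P(1) by blast
      ultimately show ?thesis using set_partitionsD[OF P(1)] P(2) by (simp add: set_partitions_def)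
    next
      assume "P' \<in> ?ext ` ?Y"
      then obtain P B where P: "P \<in> set_partitions n (Suc k)" "B \<in> P"
        and P': "P' = insert (insert (Suc n) B) (P - {B})" by (auto simp: extend_block_def)
      note part = set_partitionsD(1)[OF P(1)]
      have "B \<subseteq> {1..n}" using partition_onD1[OF part] P(2) by blast
      moreover have "partition_on ({1..n} - B) (P - {B})"
        using part P(2) \<open>B \<subseteq> {1..n}\<close> block_nonempty[OF part]
          partition_on_insert_iff[of B "{1..n}" "P - {B}"] by (auto simp: insert_absorb)
      ultimately have "partition_on {1..Suc n} P'" unfolding P'
        by (subst partition_on_Suc_insert_iff) (use le P in auto)
      moreover have "insert (Suc n) B \<notin> P - {B}" using le[OF P(1)] by blast
      ultimately show ?thesis using set_partitionsD[OF P(1)] P(2) P'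
        by (simp add: set_partitions_def)
    qed
  qed
  have disjoint: "?add ` ?X \<inter> ?ext ` ?Y = {}"
  proof -
    have False
      if *: "insert {Suc n} P = extend_block (Suc n) P' B" and
        that: "P \<in> ?X" "P' \<in> set_partitions n (Suc k)" "B \<in> P'" for P P' B
    proof -
      have "{} = B"
        by (rule insert_block_inject(1)[OF *[unfolded extend_block_def]]) (use that le in auto)
      then show False using block_nonempty[OF set_partitionsD(1)[OF that(2)] that(3)] by simp
    qed
    then show ?thesis by (auto simp only: disjoint_iff image_iff mem_Sigma_iff case_prod_conv)
  qed
  have inj_add: "inj_on ?add ?X"
    by (rule inj_onI, rule insert_block_inject(2)[where B = "{}" and C = "{}"]) (use le in auto)
  have inj_ext: "inj_on ?ext ?Y"
  proof (rule inj_onI; clarify)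
    fix P B Q C assume *: "P \<in> set_partitions n (Suc k)" "B \<in> P"
      "Q \<in> set_partitions n (Suc k)" "C \<in> Q" "extend_block (Suc n) P B = extend_block (Suc n) Q C"
    have "B = C" "P - {B} = Q - {C}"
      using insert_block_inject[OF *(5)[unfolded extend_block_def]] le[OF *(1)] le[OF *(3)] *(2,4)
      by simp_all
    then show "P = Q \<and> B = C" using *(2,4) by (metis insert_Diff)
  qed
  have "finite ?X" "finite ?Y"
    using finite_set_partitions set_partitionsD(2) by (blast intro: finite_SigmaI)+
  then have "sum g (set_partitions (Suc n) (Suc k)) = sum g (?add ` ?X) + sum g (?ext ` ?Y)"
    unfolding cases using disjoint by (intro sum.union_disjoint finite_imageI)
  also have "sum g (?add ` ?X) = (\<Sum>P\<in>?X. g (insert {Suc n} P))"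
    by (simp only: sum.reindex[OF inj_add] o_def)
  also have "sum g (?ext ` ?Y) = (\<Sum>(P, B)\<in>?Y. g (extend_block (Suc n) P B))"
    by (subst sum.reindex[OF inj_ext]) (simp add: case_prod_unfold)
  also have "\<dots> = (\<Sum>P\<in>set_partitions n (Suc k). \<Sum>B\<in>P. g (extend_block (Suc n) P B))"
    by (rule sum.Sigma[symmetric]) (auto simp: finite_set_partitions set_partitionsD(2))
  finally show ?thesis .
qed

section \<open>Sums over partitions with open blocks\<close>

lemma sum_Pow_insert:
  assumes "finite A" "a \<notin> A"
  shows "sum g (Pow (insert a A)) = (\<Sum>Q\<in>Pow A. g Q + g (insert a Q))"
proof -
  have "inj_on (insert a) (Pow A)"
    using assms(2) by (intro inj_onI) (metis PowD insert_ident subsetD)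
  moreover have "Pow A \<inter> insert a ` Pow A = {}" using assms(2) by auto
  ultimately show ?thesis using assms(1)
    by (simp add: Pow_insert sum.union_disjoint sum.reindex sum.distrib)
qed

definition open_sum :: "nat \<Rightarrow> nat \<Rightarrow> (nat \<Rightarrow> nat \<Rightarrow> 'a) \<Rightarrow> 'a::comm_monoid_add" where
  "open_sum n k f = (\<Sum>P\<in>set_partitions n k. \<Sum>Q\<in>Pow P. f (open_crossings P Q) (card Q))"

lemma sum_open_add_singleton:
  assumes "partition_on {1..n} P"
  shows "(\<Sum>Q\<in>Pow (insert {Suc n} P). f (open_crossings (insert {Suc n} P) Q) (card Q)) =
    (\<Sum>Q\<in>Pow P. f (open_crossings P Q) (card Q) + f (open_crossings P Q) (Suc (card Q)))"
proof -
  have new: "{Suc n} \<notin> P" using block_le[OF assms] by fastforce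
  have fin: "finite P" by (rule finite_blocks[OF assms])
  have "card (insert {Suc n} Q) = Suc (card Q)" if "Q \<subseteq> P" for Q
    using that new fin by (meson card_insert_disjoint finite_subset subsetD)
  then show ?thesis
    unfolding sum_Pow_insert[OF fin new]
    by (intro sum.cong refl) (simp add: open_crossings_add_singleton[OF assms])
qed

text \<open>
  A set of open blocks of the extended partition either contains the extended block or not. In
  both cases it comes from a set \<open>Q\<close> of open blocks of \<open>P\<close> with \<open>B \<in> Q\<close>: only an open block can
  be extended. Exchanging the sums over \<open>B\<close> and \<open>Q\<close> then allows the crossings created to be counted
  by rank.
\<close>

lemma sum_open_extend_block:
  fixes f :: "nat \<Rightarrow> nat \<Rightarrow> 'a::comm_monoid_add"
  assumes P: "partition_on {1..n} P"
  shows "(\<Sum>B\<in>P. \<Sum>Q\<in>Pow (extend_block (Suc n) P B).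
      f (open_crossings (extend_block (Suc n) P B) Q) (card Q)) =
    (\<Sum>Q\<in>Pow P. \<Sum>r<card Q. f (open_crossings P Q + r) (card Q - 1) + f (open_crossings P Q + r) (card Q))"
proof -
  have fin: "finite P" by (rule finite_blocks[OF P])
  define h where "h Q r = f (open_crossings P Q + r) (card Q - 1) + f (open_crossings P Q + r) (card Q)" for Q r
  have "(\<Sum>Q\<in>Pow (extend_block (Suc n) P B). f (open_crossings (extend_block (Suc n) P B) Q) (card Q))
      = (\<Sum>Q\<in>{Q \<in> Pow P. B \<in> Q}. h Q (card {C \<in> Q. Max B < Max C}))" if B: "B \<in> P" for B
  proof -
    let ?g = "\<lambda>Q. f (open_crossings (extend_block (Suc n) P B) Q) (card Q)"
    have new: "insert (Suc n) B \<notin> P" using block_le[OF P] by fastforce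
    have "sum ?g (Pow (extend_block (Suc n) P B))
        = (\<Sum>Q\<in>Pow (P - {B}). ?g Q + ?g (insert (insert (Suc n) B) Q))"
      unfolding extend_block_def by (rule sum_Pow_insert) (use fin new in auto)
    also have "\<dots> = (\<Sum>Q\<in>{Q \<in> Pow P. B \<in> Q}. ?g (Q - {B}) + ?g (insert (insert (Suc n) B) (Q - {B})))"
      by (rule sum.reindex_bij_witness[of _ "\<lambda>Q. Q - {B}" "insert B"])
        (use B in \<open>auto simp: insert_absorb subset_Diff_insert\<close>)
    also have "\<dots> = (\<Sum>Q\<in>{Q \<in> Pow P. B \<in> Q}. h Q (card {C \<in> Q. Max B < Max C}))"
    proof (rule sum.cong[OF refl])
      fix Q assume "Q \<in> {Q \<in> Pow P. B \<in> Q}"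
      then have Q: "Q \<subseteq> P" "B \<in> Q" by auto
      then have "finite Q" using fin finite_subset by blast
      moreover have "insert (Suc n) B \<notin> Q - {B}" using new Q by blast
      ultimately have "card (insert (insert (Suc n) B) (Q - {B})) = card Q"
        using Q(2) by (metis card.remove card_insert_disjoint finite_Diff)
      then show "?g (Q - {B}) + ?g (insert (insert (Suc n) B) (Q - {B})) = h Q (card {C \<in> Q. Max B < Max C})"
        using Q \<open>finite Q\<close> by (simp add: h_def open_crossings_extend_block[OF P] card_Diff_singleton)
    qed
    finally show ?thesis .
  qed
  then have "(\<Sum>B\<in>P. \<Sum>Q\<in>Pow (extend_block (Suc n) P B).
      f (open_crossings (extend_block (Suc n) P B) Q) (card Q))
    = (\<Sum>B\<in>P. \<Sum>Q\<in>{Q \<in> Pow P. B \<in> Q}. h Q (card {C \<in> Q. Max B < Max C}))"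
    by (rule sum.cong[OF refl])
  also have "\<dots> = (\<Sum>Q\<in>Pow P. \<Sum>B\<in>{B \<in> P. B \<in> Q}. h Q (card {C \<in> Q. Max B < Max C}))"
    by (rule sum.swap_restrict) (use fin in auto)
  also have "\<dots> = (\<Sum>Q\<in>Pow P. \<Sum>r<card Q. h Q r)"
  proof (rule sum.cong[OF refl])
    fix Q assume "Q \<in> Pow P"
    then have "{B \<in> P. B \<in> Q} = Q" and Q: "Q \<subseteq> P" by auto
    then show "(\<Sum>B\<in>{B \<in> P. B \<in> Q}. h Q (card {C \<in> Q. Max B < Max C})) = (\<Sum>r<card Q. h Q r)"
      using sum_open_blocks_rank[OF P Q] by simp
  qed
  finally show ?thesis by (simp add: h_def)
qed

text \<open>
  In both summands the block of the new element is either closed or open. If it extends an open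
  block of rank \<open>r\<close>, then \<open>h - 1\<close> of the old open blocks remain untouched.
\<close>

lemma open_sum_Suc:
  "open_sum (Suc n) (Suc k) f = open_sum n k (\<lambda>c h. f c h + f c (Suc h)) +
    open_sum n (Suc k) (\<lambda>c h. \<Sum>r<h. f (c + r) (h - 1) + f (c + r) h)"
  unfolding open_sum_def sum_set_partitions_Suc
  by (intro arg_cong2[where f = "(+)"] sum.cong refl sum_open_add_singleton sum_open_extend_block)
    (auto dest: set_partitionsD)

lemma open_sum_Suc_0: "open_sum (Suc n) 0 f = 0"
  by (simp add: open_sum_def set_partitions_Suc_0)

lemma open_sum_0: "open_sum 0 k f = (if k = 0 then f 0 0 else 0)"
proof -
  have "arcs {} = {}" by (auto simp: arcs_def)
  then have "open_crossings {} {} = 0" by (simp add: open_crossings_empty crossings_def case_prod_unfold)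
  then show ?thesis by (simp add: open_sum_def set_partitions_0)
qed

text \<open>
  The Stirling recurrence for all integers \<open>j\<close>, so that no boundary case is needed when it is
  applied to \<open>S n (int k - 1)\<close> and \<open>S n (int k - 2)\<close>.
\<close>

lemma S_Suc: "real (S (Suc n) j) = of_int j * real (S n j) + real (S n (j - 1))"
proof (cases "j \<le> 0")
  case True
  then show ?thesis by (cases "j = 0") (auto simp: S_def set_partitions_Suc_0)
next
  case False
  define k where "k = nat (j - 1)"
  have j: "j = int (Suc k)" using False by (simp add: k_def)
  have "card (set_partitions (Suc n) (Suc k)) =
    card (set_partitions n k) + (\<Sum>P\<in>set_partitions n (Suc k). card P)"
    using sum_set_partitions_Suc[of "\<lambda>_. 1 :: nat" n k] by simp
  also have "(\<Sum>P\<in>set_partitions n (Suc k). card P) = Suc k * card (set_partitions n (Suc k))"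
    by (simp add: set_partitionsD(3) cong: sum.cong)
  finally have "S (Suc n) (int (Suc k)) = S n (int k) + Suc k * S n (int (Suc k))"
    by (simp only: S_def nat_int) simp
  then show ?thesis by (simp add: j algebra_simps)
qed

lemma S_0: "S 0 j = (if j = 0 then 1 else 0)"
  by (simp add: S_def set_partitions_0 nat_eq_iff)

section \<open>Generating polynomials of the binomial moments\<close>

text \<open>
  The coefficient of \<open>(q - 1)^j\<close> in the expansion at \<open>q = 1\<close> of the sum of
  \<open>q^(open_crossings P Q) * x^(card Q)\<close>.
\<close>

definition crossing_poly :: "nat \<Rightarrow> nat \<Rightarrow> nat \<Rightarrow> real poly" where
  "crossing_poly j n k = open_sum n k (\<lambda>c h. monom (real (c choose j)) h)"

text \<open>
  The factor \<open>1 + x\<close> records the choice whether the block of the new element is open.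
\<close>

lemma crossing_poly_Suc:
  "crossing_poly j (Suc n) (Suc k) = [:1, 1:] * (crossing_poly j n k +
    open_sum n (Suc k) (\<lambda>c h. monom (\<Sum>r<h. real ((c + r) choose j)) (h - 1)))"
proof -
  have 1: "monom a h + monom a (Suc h) = [:1, 1:] * monom a h" for a :: real and h
    by (simp add: monom_Suc)
  have 2: "(\<Sum>r<h. monom (w r) (h - 1) + monom (w r) h) = [:1, 1:] * monom (sum w {..<h}) (h - 1)"
    for w :: "nat \<Rightarrow> real" and h
  proof (cases h)
    case (Suc h')
    then show ?thesis by (simp only: diff_Suc_1 1 monom_sum sum_distrib_left)
  qed simp
  show ?thesis
    unfolding crossing_poly_def open_sum_Suc 1 2
    by (simp only: open_sum_def sum_distrib_left distrib_left)
qed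

lemma real_choose_two: "real (m choose 2) = real m * (real m - 1) / 2"
  by (induction m) (simp_all add: numeral_2_eq_2 field_simps)

text \<open>
  These two sums are the coefficients of \<open>(q - 1)^j\<close> in \<open>q^c * (1 + q + \<dots> + q^(h - 1))\<close> for
  \<open>j = 1\<close> and \<open>j = 2\<close>. Multiplication of \<open>x^(h - 1)\<close> by a falling factorial of \<open>h\<close> is a
  differential operator, hence the derivatives below.
\<close>

lemma sum_shifted_choose_1: "(\<Sum>r<h. real (c + r)) = real h * real c + real h * (real h - 1) / 2"
  by (induction h) (simp_all add: field_simps)

lemma sum_shifted_choose_2:
  "(\<Sum>r<h. real ((c + r) choose 2)) =
    real h * real (c choose 2) + real h * (real h - 1) / 2 * real c
    + real h * (real h - 1) * (real h - 2) / 6"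
  by (induction h) (simp_all add: real_choose_two field_simps)

lemma X_times_monom: "[:0, 1:] * monom (a::real) h = monom a (Suc h)"
  by (simp add: monom_Suc)

lemma X_times_pderiv2_monom:
  "[:0, 1:] * pderiv (pderiv (monom (a::real) h)) = monom (real h * (real h - 1) * a) (h - 1)"
  by (cases h; cases "h - 1") (simp_all add: pderiv_monom monom_Suc[symmetric] del: pCons_eq_0_iff)

lemma X2_times_pderiv3_monom:
  "[:0, 1:]\<^sup>2 * pderiv (pderiv (pderiv (monom (a::real) h))) =
    monom (real h * (real h - 1) * (real h - 2) * a) (h - 1)"
proof -
  consider "h = 0" | "h = 1" | "h = 2" | m where "h = Suc (Suc (Suc m))"
    by (metis One_nat_def numeral_2_eq_2 old.nat.exhaust)
  then show ?thesis
    by cases (simp_all add: pderiv_monom X_times_monom power2_eq_square mult.assoc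
        del: mult_pCons_left, simp_all add: algebra_simps monom_Suc)
qed

lemma open_sum_additive:
  assumes "L 0 = 0" "\<And>x y. L (x + y) = L x + L y"
  shows "open_sum n k (\<lambda>c h. L (f c h)) = L (open_sum n k f)"
  by (simp add: open_sum_def sum_comp_morphism[of L, OF assms, unfolded o_def])

lemmas pderiv_open_sum = open_sum_additive[of pderiv, OF pderiv_0 pderiv_add]
lemmas smult_open_sum = open_sum_additive[of "smult a" for a, OF smult_0_right smult_add_right]
lemmas mult_open_sum =
  open_sum_additive[of "(*) p" for p :: "'a::comm_semiring_0 poly", OF mult_zero_right distrib_left]

lemma open_sum_add:
  "open_sum n k (\<lambda>c h. f c h + g c h) = open_sum n k f + open_sum n k g"
  by (simp add: open_sum_def sum.distrib)

lemma crossing_poly_0_Suc: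
  "crossing_poly 0 (Suc n) (Suc k) =
    [:1, 1:] * (crossing_poly 0 n k + pderiv (crossing_poly 0 n (Suc k)))"
  unfolding crossing_poly_Suc unfolding crossing_poly_def pderiv_open_sum[symmetric]
  by (simp add: pderiv_monom)

lemma crossing_poly_1_Suc:
  "crossing_poly 1 (Suc n) (Suc k) =
    [:1, 1:] * (crossing_poly 1 n k + pderiv (crossing_poly 1 n (Suc k))
      + smult (1 / 2) ([:0, 1:] * pderiv (pderiv (crossing_poly 0 n (Suc k)))))"
proof -
  have *: "monom (\<Sum>r<h. real ((c + r) choose 1)) (h - 1) = pderiv (monom (real (c choose 1)) h)
      + smult (1 / 2) ([:0, 1:] * pderiv (pderiv (monom (real (c choose 0)) h)))" for c h
    unfolding X_times_pderiv2_monom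
    using sum_shifted_choose_1[of c h] by (simp add: pderiv_monom smult_monom add_monom)
  show ?thesis
    unfolding crossing_poly_Suc *
    by (simp only: crossing_poly_def open_sum_add pderiv_open_sum smult_open_sum mult_open_sum add.assoc)
qed

lemma crossing_poly_2_Suc:
  "crossing_poly 2 (Suc n) (Suc k) =
    [:1, 1:] * (crossing_poly 2 n k + pderiv (crossing_poly 2 n (Suc k))
      + smult (1 / 2) ([:0, 1:] * pderiv (pderiv (crossing_poly 1 n (Suc k))))
      + smult (1 / 6) ([:0, 1:]\<^sup>2 * pderiv (pderiv (pderiv (crossing_poly 0 n (Suc k))))))"
proof -
  have *: "monom (\<Sum>r<h. real ((c + r) choose 2)) (h - 1) = pderiv (monom (real (c choose 2)) h)
      + smult (1 / 2) ([:0, 1:] * pderiv (pderiv (monom (real (c choose 1)) h)))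
      + smult (1 / 6) ([:0, 1:]\<^sup>2 * pderiv (pderiv (pderiv (monom (real (c choose 0)) h))))" for c h
    unfolding X_times_pderiv2_monom X2_times_pderiv3_monom
    using sum_shifted_choose_2[of c h] by (simp add: pderiv_monom smult_monom add_monom)
  show ?thesis
    unfolding crossing_poly_Suc *
    by (simp only: crossing_poly_def open_sum_add pderiv_open_sum smult_open_sum mult_open_sum add.assoc)
qed

lemma crossing_poly_Suc_0: "crossing_poly j (Suc n) 0 = 0"
  by (simp add: crossing_poly_def open_sum_Suc_0)

lemma crossing_poly_0: "crossing_poly j 0 k = (if j = 0 \<and> k = 0 then 1 else 0)"
  by (cases j) (simp_all add: crossing_poly_def open_sum_0)

text \<open>
  At \<open>x = 0\<close> only the choice \<open>Q = {}\<close> survives, for which all crossings are actual ones.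
\<close>

lemma poly_crossing_poly_0:
  "poly (crossing_poly j n k) 0 = (\<Sum>P\<in>set_partitions n k. real (crossings P choose j))"
proof -
  have "(\<Sum>Q\<in>Pow P. poly (monom (real (open_crossings P Q choose j)) (card Q)) 0) =
      real (crossings P choose j)" if P: "P \<in> set_partitions n k" for P
  proof -
    have fin: "finite P" using set_partitionsD(2)[OF P] .
    have "(\<Sum>Q\<in>Pow P. poly (monom (real (open_crossings P Q choose j)) (card Q)) 0) =
        (\<Sum>Q\<in>{{}}. real (open_crossings P Q choose j))"
    proof (rule sum.mono_neutral_cong_right)
      show "\<forall>Q\<in>Pow P - {{}}. poly (monom (real (open_crossings P Q choose j)) (card Q)) 0 = 0"
        using fin finite_subset by (fastforce simp: poly_monom)
    qed (use fin in \<open>auto simp: poly_monom\<close>)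
    then show ?thesis by (simp add: open_crossings_empty)
  qed
  then show ?thesis by (simp add: crossing_poly_def open_sum_def poly_sum cong: sum.cong)
qed

section \<open>The coefficients in powers of 1 + x\<close>

text \<open>
  With \<open>y = 1 + x\<close>, the three generating polynomials will turn out to be \<open>S n k * y^k\<close>,
  \<open>alpha * y^k + beta * y^(k - 1)\<close> and \<open>gamma * y^k + delta * y^(k - 1) + epsilon * y^(k - 2)\<close>.
  The closed forms solve the recurrences in \<open>coefficients_Suc_Suc\<close>. They result from the
  ansatz of combining \<open>S n k\<close>, \<open>S n (k - 1)\<close> and \<open>S n (k - 2)\<close> with coefficients polynomial in
  \<open>n\<close> and \<open>k\<close>: since \<open>S n (k - i)\<close> satisfies the Stirling recurrence with multiplier \<open>k - i\<close>, such
  combinations can match the multipliers \<open>k\<close>, \<open>k - 1\<close> and \<open>k - 2\<close> of these recurrences.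
\<close>

definition alpha :: "nat \<Rightarrow> nat \<Rightarrow> real" where
  "alpha n k = (let n' = real n; k' = real k in
     (k' - 1) * (2 * n' - 3 * k') / 4 * real (S n (int k))
     + (n' - k' + 1) / 2 * real (S n (int k - 1)))"

definition beta :: "nat \<Rightarrow> nat \<Rightarrow> real" where
  "beta n k = (let n' = real n; k' = real k in
     - k' * (k' - 1) / 2 * real (S n (int k)) + (n' - k' + 1) * real (S n (int k - 1)))"

definition gamma :: "nat \<Rightarrow> nat \<Rightarrow> real" where
  "gamma n k = (let n' = real n; k' = real k in
     (k' - 1) * (36 * n'\<^sup>2 * (k' - 1) - 12 * n' * (9 * k'\<^sup>2 - 10 * k' + 5)
       + k' * (81 * k'\<^sup>2 - 85 * k' + 98)) / 288 * real (S n (int k))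
     + (3 * n'\<^sup>2 * (2 * k' - 3) - n' * (15 * k'\<^sup>2 - 29 * k' + 19)
       + (k' - 1) * (9 * k'\<^sup>2 - 13 * k' + 8)) / 24 * real (S n (int k - 1))
     + (n' - k' + 2) * (3 * n' - 3 * k' + 1) / 24 * real (S n (int k - 2)))"

definition delta :: "nat \<Rightarrow> nat \<Rightarrow> real" where
  "delta n k = (let n' = real n; k' = real k in
     k' * (k' - 1) * (9 * k'\<^sup>2 - 5 * k' + 4 - 6 * n' * (k' - 1)) / 24 * real (S n (int k))
     + (n'\<^sup>2 * (k' - 2) - 3 * n' * (k' - 1)\<^sup>2 + (k' - 1) * (2 * k'\<^sup>2 - 2 * k' - 1)) / 2
       * real (S n (int k - 1))
     + (n' - k' + 2) * (n' - k' - 1) / 2 * real (S n (int k - 2)))"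

definition epsilon :: "nat \<Rightarrow> nat \<Rightarrow> real" where
  "epsilon n k = (let n' = real n; k' = real k in
     k' * (k' - 1) * (k' - 2) * (3 * k' - 1) / 24 * real (S n (int k))
     - (k' - 1) * (k' - 2) * (n' - k' + 1) / 2 * real (S n (int k - 1))
     + (n' - k' + 1) * (n' - k' + 2) / 2 * real (S n (int k - 2)))"

lemmas coefficient_defs = alpha_def beta_def gamma_def delta_def epsilon_def Let_def

lemma coefficients_0:
  "alpha 0 k = 0" "beta 0 k = 0" "gamma 0 k = 0" "delta 0 k = 0" "epsilon 0 k = 0"
proof -
  consider "k = 0" | "k = 1" | "k = 2" | "k \<ge> 3" by linarith
  then show "alpha 0 k = 0" "beta 0 k = 0" "gamma 0 k = 0" "delta 0 k = 0" "epsilon 0 k = 0"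
    by (cases; simp add: coefficient_defs S_0)+
qed

lemma coefficients_Suc_0:
  "alpha (Suc n) 0 = 0" "beta (Suc n) 0 = 0" "gamma (Suc n) 0 = 0"
  "delta (Suc n) 0 = 0" "epsilon (Suc n) 0 = 0"
  by (simp_all add: coefficient_defs S_def set_partitions_Suc_0)

text \<open>
  The recurrences that the generating polynomials impose on their coefficients. Once the Stirling
  recurrence has reduced everything to the values \<open>S n (k + 1 - i)\<close> for \<open>i \<le> 3\<close>, each of them
  is a polynomial identity.
\<close>

lemma coefficients_Suc_Suc:
  fixes n k :: nat
  defines "m \<equiv> real k + 1" and "s \<equiv> real (S n (int (Suc k)))"
  shows "alpha (Suc n) (Suc k) = alpha n k + m * alpha n (Suc k) + m * (m - 1) / 2 * s"
    and "beta (Suc n) (Suc k) = beta n k + (m - 1) * beta n (Suc k) - m * (m - 1) / 2 * s"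
    and "gamma (Suc n) (Suc k) = gamma n k + m * gamma n (Suc k)
      + m * (m - 1) / 2 * alpha n (Suc k) + m * (m - 1) * (m - 2) / 6 * s"
    and "delta (Suc n) (Suc k) = delta n k + (m - 1) * delta n (Suc k)
      - m * (m - 1) / 2 * alpha n (Suc k) + (m - 1) * (m - 2) / 2 * beta n (Suc k)
      - m * (m - 1) * (m - 2) / 3 * s"
    and "epsilon (Suc n) (Suc k) = epsilon n k + (m - 2) * epsilon n (Suc k)
      - (m - 1) * (m - 2) / 2 * beta n (Suc k) + m * (m - 1) * (m - 2) / 6 * s"
proof -
  define a where "a i = real (S n (int k - i))" for i
  have args: "int (Suc k) - 1 = int k" "int (Suc k) - 2 = int k - 1" by simp_all
  have s: "S n (int k) = a 0" "S n (int k - 1) = a 1" "S n (int k - 2) = a 2" "s = a (-1)"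
    by (simp_all add: a_def s_def add.commute)
  have S: "real (S (Suc n) (int (Suc k))) = (real k + 1) * s + a 0"
    "real (S (Suc n) (int k)) = real k * a 0 + a 1"
    "real (S (Suc n) (int k - 1)) = (real k - 1) * a 1 + a 2"
    unfolding S_Suc by (simp_all add: a_def s_def algebra_simps)
  note unfolds = coefficient_defs args S s of_nat_Suc[where 'a = real] s_def[symmetric] m_def
  show "alpha (Suc n) (Suc k) = alpha n k + m * alpha n (Suc k) + m * (m - 1) / 2 * s"
    unfolding unfolds by (simp add: field_simps power2_eq_square)
  show "beta (Suc n) (Suc k) = beta n k + (m - 1) * beta n (Suc k) - m * (m - 1) / 2 * s"
    unfolding unfolds by (simp add: field_simps power2_eq_square)
  show "gamma (Suc n) (Suc k) = gamma n k + m * gamma n (Suc k)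
      + m * (m - 1) / 2 * alpha n (Suc k) + m * (m - 1) * (m - 2) / 6 * s"
    unfolding unfolds by (simp add: field_simps power2_eq_square)
  show "delta (Suc n) (Suc k) = delta n k + (m - 1) * delta n (Suc k)
      - m * (m - 1) / 2 * alpha n (Suc k) + (m - 1) * (m - 2) / 2 * beta n (Suc k)
      - m * (m - 1) * (m - 2) / 3 * s"
    unfolding unfolds by (simp add: field_simps power2_eq_square)
  show "epsilon (Suc n) (Suc k) = epsilon n k + (m - 2) * epsilon n (Suc k)
      - (m - 1) * (m - 2) / 2 * beta n (Suc k) + m * (m - 1) * (m - 2) / 6 * s"
    unfolding unfolds by (simp add: field_simps power2_eq_square)
qed

section \<open>Solving the recurrences\<close>

definition Y :: "real poly" where
  "Y = [:1, 1:]"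

lemma pderiv_Y: "pderiv Y = 1"
  by (simp add: Y_def pderiv_pCons one_pCons)

lemma X_eq_Y_minus_1: "[:0, 1:] = Y - 1"
  by (simp add: Y_def one_pCons)

lemma Y_pderiv_Y_power: "Y * pderiv (Y ^ m) = smult (real m) (Y ^ m)"
proof (cases m)
  case (Suc j)
  show ?thesis
    unfolding Suc pderiv_power_Suc pderiv_Y by (simp del: of_nat_Suc)
qed simp

text \<open>
  The Euler operator \<open>Y * D\<close> on \<open>p\<close> turns into \<open>Y * D - r\<close> on \<open>Y ^ r * p\<close>.
  Multiplying by powers of \<open>Y\<close> in this way avoids the exponents \<open>k - 1\<close> and \<open>k - 2\<close>, which would be
  truncated for small \<open>k\<close>.
\<close>

lemma Y_power_pderiv:
  "Y ^ Suc r * pderiv p = Y * pderiv (Y ^ r * p) - smult (real r) (Y ^ r * p)"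
proof -
  have "Y * pderiv (Y ^ r * p) = Y ^ Suc r * pderiv p + (Y * pderiv (Y ^ r)) * p"
    by (simp add: pderiv_mult algebra_simps)
  then show ?thesis by (simp add: Y_pderiv_Y_power)
qed

lemma pderiv_Y_expansion:
  assumes "Y ^ r * p = smult a (Y ^ (m + 2)) + smult b (Y ^ (m + 1)) + smult c (Y ^ m)"
  shows "Y ^ Suc r * pderiv p = smult (a * (real m + 2 - real r)) (Y ^ (m + 2))
    + smult (b * (real m + 1 - real r)) (Y ^ (m + 1)) + smult (c * (real m - real r)) (Y ^ m)"
  unfolding Y_power_pderiv assms pderiv_add pderiv_smult distrib_left mult_smult_right
    Y_pderiv_Y_power
  by (simp add: algebra_simps smult_add_right smult_diff_left smult_add_left del: power_Suc power_add)

text \<open>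
  Choosing the open blocks freely among the \<open>k\<close> blocks gives the factor \<open>(1 + x)^k\<close>; the proof
  uses the recurrence, as for the two polynomials below.
\<close>

lemma crossing_poly_0_closed: "crossing_poly 0 n k = smult (real (S n (int k))) (Y ^ k)"
proof (induction n arbitrary: k)
  case 0
  then show ?case by (simp add: crossing_poly_0 S_0)
next
  case (Suc n)
  show ?case
  proof (cases k)
    case 0
    then show ?thesis by (simp add: crossing_poly_Suc_0 S_def set_partitions_Suc_0)
  next
    case (Suc j)
    have "int (Suc j) - 1 = int j" by simp
    then have S: "real (S (Suc n) (int (Suc j))) =
        real (Suc j) * real (S n (int (Suc j))) + real (S n (int j))"
      by (simp only: S_Suc of_int_of_nat_eq)
    show ?thesis
      unfolding Suc crossing_poly_0_Suc[folded Y_def] Suc.IH S pderiv_smult distrib_left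
        mult_smult_right Y_pderiv_Y_power smult_smult smult_add_left power_Suc[symmetric]
      by (simp only: add.commute mult.commute)
  qed
qed

lemma crossing_poly_0_pderivs:
  fixes n m :: nat
  defines "s \<equiv> real (S n (int m))"
  shows "Y ^ 2 * pderiv (pderiv (crossing_poly 0 n m)) = smult (s * real m * (real m - 1)) (Y ^ m)"
    and "Y ^ 3 * pderiv (pderiv (pderiv (crossing_poly 0 n m))) =
      smult (s * real m * (real m - 1) * (real m - 2)) (Y ^ m)"
proof -
  let ?p = "crossing_poly 0 n m"
  have "Y ^ 0 * ?p = smult 0 (Y ^ (m + 2)) + smult 0 (Y ^ (m + 1)) + smult s (Y ^ m)"
    by (simp add: crossing_poly_0_closed s_def)
  note 1 = pderiv_Y_expansion[OF this]
  note 2 = pderiv_Y_expansion[OF 1]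
  note 3 = pderiv_Y_expansion[OF 2]
  show "Y ^ 2 * pderiv (pderiv ?p) = smult (s * real m * (real m - 1)) (Y ^ m)"
    using 2 by (simp add: numeral_eq_Suc)
  show "Y ^ 3 * pderiv (pderiv (pderiv ?p)) =
      smult (s * real m * (real m - 1) * (real m - 2)) (Y ^ m)"
    using 3 by (simp add: numeral_eq_Suc)
qed

lemma crossing_poly_1_closed:
  "Y * crossing_poly 1 n k = smult (alpha n k) (Y ^ (k + 1)) + smult (beta n k) (Y ^ k)"
proof (induction n arbitrary: k)
  case 0
  then show ?case by (simp add: crossing_poly_0 coefficients_0)
next
  case (Suc n)
  show ?case
  proof (cases k)
    case 0
    then show ?thesis by (simp add: crossing_poly_Suc_0 coefficients_Suc_0)
  next
    case (Suc j)
    define p where "p = crossing_poly 1 n (Suc j)"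
    define q where "q = pderiv (pderiv (crossing_poly 0 n (Suc j)))"
    define s where "s = real (S n (int (Suc j)))"
    define K where "K = real j + 1"
    have K: "real (Suc j) = K" by (simp add: K_def)
    \<comment> \<open>Each summand of the recurrence, multiplied by the power of \<open>Y\<close> that turns it into a combination
      of powers of \<open>Y\<close>.\<close>
    have low: "Y * crossing_poly 1 n j = smult (alpha n j) (Y ^ (j + 1)) + smult (beta n j) (Y ^ j)"
      by (rule Suc.IH)
    have "Y ^ 1 * p = smult 0 (Y ^ (Suc j + 2)) + smult (alpha n (Suc j)) (Y ^ (Suc j + 1))
        + smult (beta n (Suc j)) (Y ^ Suc j)"
      unfolding p_def using Suc.IH[of "Suc j"] by simp
    from pderiv_Y_expansion[OF this]
    have p': "Y ^ 2 * pderiv p = smult (alpha n (Suc j) * K) (Y ^ (Suc j + 1))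
        + smult (beta n (Suc j) * (K - 1)) (Y ^ Suc j)"
      unfolding K by (simp add: numeral_eq_Suc)
    have q: "Y ^ 2 * q = smult (s * K * (K - 1)) (Y ^ Suc j)"
      unfolding q_def s_def by (simp only: crossing_poly_0_pderivs K)
    have step: "Y * crossing_poly 1 (Suc n) (Suc j) = Y * (Y * crossing_poly 1 n j) + Y ^ 2 * pderiv p
        + smult (1 / 2) ((Y - 1) * (Y ^ 2 * q))"
      unfolding crossing_poly_1_Suc[folded Y_def, unfolded X_eq_Y_minus_1] p_def q_def
      by (simp add: algebra_simps power2_eq_square smult_diff_right)
    have "Y * crossing_poly 1 (Suc n) (Suc j) = smult (alpha (Suc n) (Suc j)) (Y ^ (Suc j + 1))
        + smult (beta (Suc n) (Suc j)) (Y ^ Suc j)"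
      unfolding step low p' q coefficients_Suc_Suc K_def[symmetric] s_def[symmetric]
      by (rule poly_ext) (simp add: field_simps)
    then show ?thesis unfolding Suc .
  qed
qed

lemma crossing_poly_1_pderiv2:
  "Y ^ 3 * pderiv (pderiv (crossing_poly 1 n m)) =
    smult (alpha n m * real m * (real m - 1)) (Y ^ (m + 1))
    + smult (beta n m * (real m - 1) * (real m - 2)) (Y ^ m)"
proof -
  have "Y ^ 1 * crossing_poly 1 n m = smult 0 (Y ^ (m + 2)) + smult (alpha n m) (Y ^ (m + 1))
      + smult (beta n m) (Y ^ m)"
    using crossing_poly_1_closed[of n m] by simp
  from pderiv_Y_expansion[OF pderiv_Y_expansion[OF this]]
  show ?thesis by (simp add: numeral_eq_Suc)
qed

lemma crossing_poly_2_closed: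
  "Y ^ 2 * crossing_poly 2 n k =
    smult (gamma n k) (Y ^ (k + 2)) + smult (delta n k) (Y ^ (k + 1)) + smult (epsilon n k) (Y ^ k)"
proof (induction n arbitrary: k)
  case 0
  then show ?case by (simp add: crossing_poly_0 coefficients_0)
next
  case (Suc n)
  show ?case
  proof (cases k)
    case 0
    then show ?thesis by (simp add: crossing_poly_Suc_0 coefficients_Suc_0)
  next
    case (Suc j)
    define p where "p = crossing_poly 2 n (Suc j)"
    define q where "q = pderiv (pderiv (crossing_poly 1 n (Suc j)))"
    define r where "r = pderiv (pderiv (pderiv (crossing_poly 0 n (Suc j))))"
    define s where "s = real (S n (int (Suc j)))"
    define K where "K = real j + 1"
    have K: "real (Suc j) = K" by (simp add: K_def)
    have low: "Y ^ 2 * crossing_poly 2 n j = smult (gamma n j) (Y ^ (j + 2))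
        + smult (delta n j) (Y ^ (j + 1)) + smult (epsilon n j) (Y ^ j)"
      by (rule Suc.IH)
    have p': "Y ^ 3 * pderiv p = smult (gamma n (Suc j) * K) (Y ^ (Suc j + 2))
        + smult (delta n (Suc j) * (K - 1)) (Y ^ (Suc j + 1))
        + smult (epsilon n (Suc j) * (K - 2)) (Y ^ Suc j)"
      using pderiv_Y_expansion[OF Suc.IH[of "Suc j"]] unfolding K p_def
      by (simp add: numeral_eq_Suc)
    have q: "Y ^ 3 * q = smult (alpha n (Suc j) * K * (K - 1)) (Y ^ (Suc j + 1))
        + smult (beta n (Suc j) * (K - 1) * (K - 2)) (Y ^ Suc j)"
      unfolding q_def by (simp only: crossing_poly_1_pderiv2 K)
    have r: "Y ^ 3 * r = smult (s * K * (K - 1) * (K - 2)) (Y ^ Suc j)"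
      unfolding r_def s_def by (simp only: crossing_poly_0_pderivs K)
    have step: "Y ^ 2 * crossing_poly 2 (Suc n) (Suc j) = Y * (Y ^ 2 * crossing_poly 2 n j)
        + Y ^ 3 * pderiv p + smult (1 / 2) ((Y - 1) * (Y ^ 3 * q))
        + smult (1 / 6) ((Y - 1)\<^sup>2 * (Y ^ 3 * r))"
      unfolding crossing_poly_2_Suc[folded Y_def, unfolded X_eq_Y_minus_1] p_def q_def r_def
      by (rule poly_ext) (simp add: algebra_simps power2_eq_square power3_eq_cube)
    have "Y ^ 2 * crossing_poly 2 (Suc n) (Suc j) = smult (gamma (Suc n) (Suc j)) (Y ^ (Suc j + 2))
        + smult (delta (Suc n) (Suc j)) (Y ^ (Suc j + 1))
        + smult (epsilon (Suc n) (Suc j)) (Y ^ Suc j)"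
      unfolding step low p' q r coefficients_Suc_Suc K_def[symmetric] s_def[symmetric]
      by (rule poly_ext) (simp add: field_simps power2_eq_square)
    then show ?thesis unfolding Suc .
  qed
qed

section \<open>The variance\<close>

lemma sum_crossings_choose:
  shows "(\<Sum>P\<in>set_partitions n k. real (crossings P)) = alpha n k + beta n k"
    and "(\<Sum>P\<in>set_partitions n k. real (crossings P choose 2)) = gamma n k + delta n k + epsilon n k"
proof -
  have Y: "poly Y 0 = 1" by (simp add: Y_def)
  show "(\<Sum>P\<in>set_partitions n k. real (crossings P)) = alpha n k + beta n k"
    using crossing_poly_1_closed[of n k, THEN arg_cong[where f = "\<lambda>p. poly p 0"]]
      poly_crossing_poly_0[of 1 n k] by (simp add: Y)
  show "(\<Sum>P\<in>set_partitions n k. real (crossings P choose 2)) = gamma n k + delta n k + epsilon n k"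
    using crossing_poly_2_closed[of n k, THEN arg_cong[where f = "\<lambda>p. poly p 0"]]
      poly_crossing_poly_0[of 2 n k] by (simp add: Y)
qed

lemma variance_pmf_of_set:
  fixes f :: "'a \<Rightarrow> real"
  assumes "finite A" "A \<noteq> {}"
  shows "measure_pmf.variance (pmf_of_set A) f = (\<Sum>x\<in>A. (f x)\<^sup>2) / card A - ((\<Sum>x\<in>A. f x) / card A)\<^sup>2"
proof -
  have "integrable (measure_pmf (pmf_of_set A)) g" for g :: "'a \<Rightarrow> real"
    by (rule integrable_measure_pmf_finite) (simp add: assms)
  then show ?thesis
    by (subst measure_pmf.variance_eq) (simp_all add: integral_pmf_of_set assms)
qed

theorem theorem1p3:
  fixes n k :: nat
  assumes "1 \<le> k" and "k \<le> n"
  shows "measure_pmf.variance (uniform_partition n k) (\<lambda>\<pi>. real (crossings \<pi>)) =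
      1 / 12 * ((real k)\<^sup>2 - 1) * real n
    - 1 / 72 * real k * (real k - 1) * (2 * real k + 5)
    + 1 / 12 * (- 15 * (real n)\<^sup>2 + (56 * real k - 43) * real n
                - 2 * (real k - 1) * (14 * real k - 1))
        * (real (S n (int k - 1)) / real (S n (int k)))
    + 1 / 12 * (real n - real k + 2) * (27 * real n - 27 * real k + 1)
        * (real (S n (int k - 2)) / real (S n (int k)))
    - 9 / 4 * (real n + 1 - real k)\<^sup>2
        * (real (S n (int k - 1)) / real (S n (int k)))\<^sup>2"
proof -
  define s where "s = real (S n (int k))"
  define u v where "u = real (S n (int k - 1)) / s" and "v = real (S n (int k - 2)) / s"
  have nonempty: "set_partitions n k \<noteq> {}" by (rule set_partitions_nonempty[OF assms])
  have card: "real (card (set_partitions n k)) = s" by (simp add: s_def S_def)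
  have s: "s \<noteq> 0" using nonempty finite_set_partitions by (simp flip: card)
  have S: "real (S n (int k)) = s" "real (S n (int k - 1)) = s * u" "real (S n (int k - 2)) = s * v"
    using s by (simp_all add: s_def u_def v_def)
  \<comment> \<open>The second moment is twice the second binomial moment plus the first moment.\<close>
  have "(\<Sum>P\<in>set_partitions n k. (real (crossings P))\<^sup>2) =
      (\<Sum>P\<in>set_partitions n k. 2 * real (crossings P choose 2) + real (crossings P))"
    by (rule sum.cong) (simp_all add: real_choose_two power2_eq_square field_simps)
  also have "\<dots> = 2 * (gamma n k + delta n k + epsilon n k) + (alpha n k + beta n k)"
    by (simp add: sum.distrib sum_crossings_choose flip: sum_distrib_left)
  finally have "measure_pmf.variance (uniform_partition n k) (\<lambda>\<pi>. real (crossings \<pi>)) =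
      (2 * (gamma n k + delta n k + epsilon n k) + (alpha n k + beta n k)) / s
      - ((alpha n k + beta n k) / s)\<^sup>2"
    unfolding uniform_partition_def
    by (simp add: variance_pmf_of_set finite_set_partitions nonempty card sum_crossings_choose)
  also have "\<dots> = 2 * (gamma n k / s + delta n k / s + epsilon n k / s) + (alpha n k / s + beta n k / s)
      - (alpha n k / s + beta n k / s)\<^sup>2"
    by (simp add: add_divide_distrib)
  also have "\<dots> = 1 / 12 * ((real k)\<^sup>2 - 1) * real n
    - 1 / 72 * real k * (real k - 1) * (2 * real k + 5)
    + 1 / 12 * (- 15 * (real n)\<^sup>2 + (56 * real k - 43) * real n
                - 2 * (real k - 1) * (14 * real k - 1)) * u
    + 1 / 12 * (real n - real k + 2) * (27 * real n - 27 * real k + 1) * v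
    - 9 / 4 * (real n + 1 - real k)\<^sup>2 * u\<^sup>2"
    using s by (simp add: coefficient_defs S add_divide_distrib diff_divide_distrib)
      (simp add: field_simps power2_eq_square)
  finally show ?thesis by (simp only: u_def v_def s_def)
qed

end
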